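(* Let $d\ge 1$ and let $D_1,\dots,D_n$ be caps on the unit $d$-sphere $S^d\subset\mathbb{R}^{d+1}$ with spherical radii $r_1,\dots,r_n$ respectively. If every great sphere of $S^d$ intersects at least one of the caps $D_1,\dots,D_n$, then $\sum_{i=1}^n r_i\ge \pi/2$.
   Context: $S^d$ is the unit sphere in $\mathbb{R}^{d+1}$ centered at the origin; the spherical distance between two points is the angle between them as unit vectors. A cap of spherical radius $r$ is the set of points of $S^d$ within spherical distance $r$ (at distance at most $r$) of a given point of $S^d$. A great sphere is the intersection of $S^d$ with a hyperplane passing through the origin. *)

theory Defs
  imports "HOL-Analysis.Analysis"
begin

text \<open>The unit sphere \<open>S\<^sup>d\<close> is \<open>sphere 0 1\<close> in a Euclidean space of dimension \<open>d + 1\<close>.\<close>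

text \<open>The angle between two unit vectors; only meaningful when both arguments have norm 1.\<close>

definition spherical_dist :: "'a::euclidean_space \<Rightarrow> 'a \<Rightarrow> real" where
  "spherical_dist x y = arccos (x \<bullet> y)"

definition cap :: "'a::euclidean_space \<Rightarrow> real \<Rightarrow> 'a set" where
  "cap c r = {x \<in> sphere 0 1. spherical_dist c x \<le> r}"

text \<open>Radii are nonnegative (a cap contains its center). Radius 0 and radii of at least \<open>\<pi>\<close>,
  which give the whole sphere, are allowed.\<close>

definition is_cap_of_radius :: "'a::euclidean_space set \<Rightarrow> real \<Rightarrow> bool" where
  "is_cap_of_radius D r \<longleftrightarrow> 0 \<le> r \<and> (\<exists>c \<in> sphere 0 1. D = cap c r)"

definition great_sphere :: "'a::euclidean_space set \<Rightarrow> bool" where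
  "great_sphere G \<longleftrightarrow> (\<exists>a. a \<noteq> 0 \<and> G = sphere 0 1 \<inter> {x. a \<bullet> x = 0})"

end

(* A hyperplane with unit normal a meets the cap of centre c and radius r < pi/2 only if
   |a . c| <= sin r, so the hypothesis says that the zones of half-widths r_i around the great
   spheres orthogonal to c_i cover the sphere. If the half-widths had sum below pi/2, then for large N
   they could be cut into at most N zones of half-width below pi/(2N). The middle hyperplanes of these
   zones define a product P of at most N affine functions (the polynomial argument of Glazyrin,
   Karasev and Polyanskii). Let |P| be maximal on the sphere at p. On every great circle through p,
   P is a trigonometric polynomial of degree at most N, so by M. Riesz's lemma its zeros have
   distance at least pi/(2N) from p. Hence p lies in none of the zones. *)

theory Submission
  imports Defs "HOL-Computational_Algebra.Polynomial"
begin

section \<open>Trigonometric polynomials and the number of their zeros\<close>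

text \<open>Multiplication by \<open>cis t ^ n\<close> clears the negative frequencies: a real
  trigonometric polynomial of degree at most n becomes an ordinary polynomial of degree at most 2n
  in z = \<open>cis t\<close>. Its zeros in one period can then be counted as roots of
  \<open>p\<close>.\<close>

definition trig_poly :: "nat \<Rightarrow> (real \<Rightarrow> real) \<Rightarrow> bool" where
  "trig_poly n f \<longleftrightarrow> (\<exists>p :: complex poly. degree p \<le> 2 * n \<and>
     (\<forall>t. of_real (f t) * cis t ^ n = poly p (cis t)))"

lemma trig_polyI:
  assumes "degree (p :: complex poly) \<le> 2 * n" "\<And>t. of_real (f t) * cis t ^ n = poly p (cis t)"
  shows "trig_poly n f"
  using assms unfolding trig_poly_def by blast

lemma trig_poly_const: "trig_poly 0 (\<lambda>_. c)"
  by (rule trig_polyI[where p = "[:of_real c:]"]) auto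

lemma trig_poly_linear: "trig_poly 1 (\<lambda>t. a * cos t + b * sin t + c)"
proof (rule trig_polyI)
  \<comment> \<open>Euler's formulas give a cos t + b sin t = ((a + ib) / 2) z^(-1) + ((a - ib) / 2)
    z with z = \<open>cis t\<close>; multiply by z.\<close>
  let ?p = "[:Complex (a / 2) (b / 2), of_real c, Complex (a / 2) (- b / 2):] :: complex poly"
  show "degree ?p \<le> 2 * 1" by simp
  fix t
  have "a * (cos t)\<^sup>2 + a * (sin t)\<^sup>2 = a * 1" "b * (cos t)\<^sup>2 + b * (sin t)\<^sup>2 = b * 1"
    unfolding distrib_left[symmetric] by simp_all
  then show "of_real (a * cos t + b * sin t + c) * cis t ^ 1 = poly ?p (cis t)"
    by (simp add: complex_eq_iff algebra_simps power2_eq_square)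
qed

lemma trig_poly_cos: "trig_poly n (\<lambda>t. cos (real n * t))"
proof (rule trig_polyI)
  let ?p = "smult (1/2) (monom 1 (2 * n) + 1) :: complex poly"
  show "degree ?p \<le> 2 * n"
    by (intro order.trans[OF degree_smult_le] degree_add_le) (auto simp: degree_monom_le)
  fix t :: real
  have "cis t ^ (2 * n) = cis (n * t) * cis (n * t)"
    by (simp add: mult_2 power_add Complex.DeMoivre)
  moreover have "cos (n * t) * cos (n * t) = 1 - sin (n * t) * sin (n * t)"
    using sin_cos_squared_add3[of "n * t"] by linarith
  ultimately show "of_real (cos (n * t)) * cis t ^ n = poly ?p (cis t)"
    by (simp add: poly_monom Complex.DeMoivre complex_eq_iff power2_eq_square)
qed

lemma trig_poly_mult:
  assumes "trig_poly m f" "trig_poly n g"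
  shows "trig_poly (m + n) (\<lambda>t. f t * g t)"
proof -
  obtain p q where p: "degree p \<le> 2 * m" "\<And>t. of_real (f t) * cis t ^ m = poly p (cis t)"
    and q: "degree q \<le> 2 * n" "\<And>t. of_real (g t) * cis t ^ n = poly q (cis t)"
    using assms unfolding trig_poly_def by blast
  show ?thesis
  proof (rule trig_polyI)
    show "degree (p * q) \<le> 2 * (m + n)"
      using degree_mult_le[of p q] p(1) q(1) by simp
    show "of_real (f t * g t) * cis t ^ (m + n) = poly (p * q) (cis t)" for t
      by (simp add: p(2)[symmetric] q(2)[symmetric] power_add mult_ac)
  qed
qed

lemma trig_poly_diff:
  assumes "trig_poly n f" "trig_poly n g"
  shows "trig_poly n (\<lambda>t. f t - g t)"
proof -
  obtain p q where p: "degree p \<le> 2 * n" "\<And>t. of_real (f t) * cis t ^ n = poly p (cis t)"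
    and q: "degree q \<le> 2 * n" "\<And>t. of_real (g t) * cis t ^ n = poly q (cis t)"
    using assms unfolding trig_poly_def by blast
  show ?thesis
  proof (rule trig_polyI)
    show "degree (p - q) \<le> 2 * n"
      using p(1) q(1) by (rule degree_diff_le)
    show "of_real (f t - g t) * cis t ^ n = poly (p - q) (cis t)" for t
      by (simp add: p(2)[symmetric] q(2)[symmetric] algebra_simps)
  qed
qed

lemma trig_poly_mono:
  assumes "trig_poly m f" "m \<le> n"
  shows "trig_poly n f"
proof -
  obtain p where p: "degree p \<le> 2 * m" "\<And>t. of_real (f t) * cis t ^ m = poly p (cis t)"
    using assms unfolding trig_poly_def by blast
  show ?thesis
  proof (rule trig_polyI)
    show "degree (p * monom 1 (n - m)) \<le> 2 * n"
      using degree_mult_le[of p "monom 1 (n - m)"] p(1) degree_monom_le[of "1::complex" "n - m"]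
        assms(2) by linarith
    show "of_real (f t) * cis t ^ n = poly (p * monom 1 (n - m)) (cis t)" for t
      using assms(2) by (simp add: p(2)[symmetric] poly_monom mult.assoc flip: power_add)
  qed
qed

lemma trig_poly_shift:
  assumes "trig_poly n f"
  shows "trig_poly n (\<lambda>t. f (t - s))"
proof -
  obtain p where p: "degree p \<le> 2 * n" "\<And>t. of_real (f t) * cis t ^ n = poly p (cis t)"
    using assms unfolding trig_poly_def by blast
  show ?thesis
  proof (rule trig_polyI)
    let ?q = "smult (cis s ^ n) (p \<circ>\<^sub>p [:0, cis (- s):])"
    have "degree ?q \<le> degree (p \<circ>\<^sub>p [:0, cis (- s):])" by (rule degree_smult_le)
    also have "\<dots> \<le> degree p" using degree_pcompose_le[of p "[:0, cis (- s):]"] by simp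
    finally show "degree ?q \<le> 2 * n" using p(1) by linarith
    show "of_real (f (t - s)) * cis t ^ n = poly ?q (cis t)" for t
    proof -
      have "of_real (f (t - s)) * cis t ^ n = cis s ^ n * (of_real (f (t - s)) * cis (t - s) ^ n)"
        by (simp add: cis_mult mult.left_commute flip: power_mult_distrib)
      also have "\<dots> = poly ?q (cis t)"
        unfolding p(2) by (simp add: poly_pcompose cis_mult)
      finally show ?thesis .
    qed
  qed
qed

lemma trig_poly_prod:
  assumes "finite J" "\<And>j. j \<in> J \<Longrightarrow> trig_poly 1 (f j)"
  shows "trig_poly (card J) (\<lambda>t. \<Prod>j\<in>J. f j t)"
  using assms
proof (induction J rule: finite_induct)
  case empty
  then show ?case by (simp add: trig_poly_const)
next
  case (insert j J)
  then show ?case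
    using trig_poly_mult[of 1 "f j" "card J" "\<lambda>t. \<Prod>j\<in>J. f j t"] by simp
qed

lemma inj_on_cis: "inj_on cis {0..<2 * pi}"
proof (rule inj_on_inverseI)
  show "Arg2pi (cis t) = t" if "t \<in> {0..<2 * pi}" for t
    using that by (intro Arg2pi_unique[of 1]) (auto simp: cis_conv_exp)
qed

text \<open>\<open>cis\<close> is injective on a half-open period, so the points of \<open>Z\<close>
  give more than 2n distinct roots of a polynomial of degree at most 2n.\<close>

lemma trig_poly_eq_0:
  assumes "trig_poly n f" "finite Z" "Z \<subseteq> {0..<2 * pi}" "card Z > 2 * n"
    and "\<And>t. t \<in> Z \<Longrightarrow> f t = 0"
  shows "f t = 0"
proof -
  obtain p where p: "degree p \<le> 2 * n" "\<And>t. of_real (f t) * cis t ^ n = poly p (cis t)"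
    using assms(1) unfolding trig_poly_def by blast
  have "p = 0"
  proof (rule ccontr)
    assume "p \<noteq> 0"
    have "card Z = card (cis ` Z)"
      using inj_on_subset[OF inj_on_cis assms(3)] by (simp add: card_image)
    also have "\<dots> \<le> card {z. poly p z = 0}"
    proof (rule card_mono[OF poly_roots_finite[OF \<open>p \<noteq> 0\<close>]])
      show "cis ` Z \<subseteq> {z. poly p z = 0}"
        using assms(5) p(2)[symmetric] by force
    qed
    also have "\<dots> \<le> degree p" by (rule card_poly_roots_bound[OF \<open>p \<noteq> 0\<close>])
    finally show False using p(1) assms(4) by simp
  qed
  then show ?thesis using p(2)[of t] by simp
qed

lemma trig_poly_finite_zeros:
  assumes "trig_poly n f" "f s \<noteq> 0"
  shows "finite {t \<in> {0..<2 * pi}. f t = 0}"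
proof (rule ccontr)
  assume "infinite {t \<in> {0..<2 * pi}. f t = 0}"
  then obtain Z where "finite Z" "card Z = 2 * n + 1" "Z \<subseteq> {t \<in> {0..<2 * pi}. f t = 0}"
    using infinite_arbitrarily_large by blast
  then have "f s = 0"
    by - (rule trig_poly_eq_0[OF assms(1), of Z], auto)
  then show False using assms(2) by simp
qed

section \<open>M. Riesz's lemma on zeros near a maximum\<close>

lemma sign_changes_imp_zeros:
  fixes f s :: "_ \<Rightarrow> real"
  assumes "continuous_on UNIV f"
    and "\<And>i. i < n \<Longrightarrow> s i < s (Suc i)"
    and "\<And>i. i < n \<Longrightarrow> f (s i) * f (s (Suc i)) < 0"
  shows "\<exists>Z. finite Z \<and> card Z = n \<and> Z \<subseteq> {s 0<..<s n} \<and> (\<forall>x\<in>Z. f x = 0)"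
  using assms(2,3)
proof (induction n)
  case 0
  then show ?case by (intro exI[of _ "{}"]) auto
next
  case (Suc n)
  then obtain Z where Z: "finite Z" "card Z = n" "Z \<subseteq> {s 0<..<s n}" "\<forall>x\<in>Z. f x = 0"
    by (metis less_SucI)
  have mono: "s 0 \<le> s k" if "k \<le> n" for k
    using that
  proof (induction k)
    case (Suc k)
    then show ?case using Suc.prems Suc.IH \<open>\<And>i. i < Suc n \<Longrightarrow> s i < s (Suc i)\<close>[of k] by simp
  qed simp
  have lt: "s n < s (Suc n)" and sg: "f (s n) * f (s (Suc n)) < 0" using Suc.prems by auto
  have c: "continuous_on {s n..s (Suc n)} f"
    using assms(1) continuous_on_subset by blast
  obtain x where x: "s n \<le> x" "x \<le> s (Suc n)" "f x = 0"
  proof (cases "f (s n) < 0")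
    case True
    then have "f (s (Suc n)) > 0" using sg by (simp add: mult_less_0_iff)
    then show ?thesis using IVT'[of f "s n" 0 "s (Suc n)"] True lt c that by force
  next
    case False
    then have "f (s (Suc n)) < 0" "f (s n) > 0" using sg by (auto simp: mult_less_0_iff)
    then show ?thesis using IVT2'[of f "s (Suc n)" 0 "s n"] lt c that by force
  qed
  \<comment> \<open>The strict sign change rules out the endpoints, so \<open>x\<close> lies to the
    right of \<open>s n\<close> and is a new zero.\<close>
  have ne: "x \<noteq> s n" "x \<noteq> s (Suc n)" using x(3) sg by auto
  show ?case
  proof (intro exI conjI)
    show "finite (insert x Z)" using Z by simp
    show "card (insert x Z) = Suc n" using Z x by (subst card_insert_disjoint) auto
    show "insert x Z \<subseteq> {s 0<..<s (Suc n)}" using Z x ne mono[of n] lt by force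
    show "\<forall>x\<in>insert x Z. f x = 0" using Z x by simp
  qed
qed

text \<open>M. Riesz's comparison with \<open>cos (n t)\<close>: if \<open>f\<close> vanished at \<open>b < \<pi> / (2 n)\<close>, then
  \<open>cos (n t)\<close> minus a slightly shrunk and shifted copy of \<open>f\<close> would change sign once too often.\<close>

lemma trig_poly_zero_dist:
  assumes f: "trig_poly n f" "continuous_on UNIV f" and n: "n > 0"
    and max: "f 0 \<noteq> 0" "\<And>t. \<bar>f t\<bar> \<le> \<bar>f 0\<bar>"
    and b: "0 \<le> b" "b < pi / (2 * n)"
  shows "f b \<noteq> 0"
proof
  assume fb: "f b = 0"
  \<comment> \<open>Half of the gap: the zero of the shifted copy, at \<open>b + e\<close>, still
    lies below pi/(2n), where cos (n t) is positive.\<close>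
  define e where "e = (pi / (2 * n) - b) / 2"
  have e: "0 < e" "b + e < pi / (2 * n)" using b by (auto simp: e_def field_simps)
  have b0: "0 < b" using fb max(1) b(1) by (cases "b = 0") auto
  \<comment> \<open>Any value strictly between cos (n e) and 1 would do: below 1 it keeps the copy
    inside (-1, 1), and above cos (n e) it makes the copy exceed cos (n t) at t = e.\<close>
  define c where "c = (1 + cos (n * e)) / 2"
  have small: "0 < n * e" "n * e < pi / 2" "0 < n * (b + e)" "n * (b + e) < pi / 2"
  proof -
    have "n * (b + e) < n * (pi / (2 * n))" using e n by (intro mult_strict_left_mono) auto
    then show "n * (b + e) < pi / 2" using n by simp
    moreover have "n * e < n * (b + e)" "0 < n * e" using b0 e n by auto
    ultimately show "0 < n * e" "n * e < pi / 2" "0 < n * (b + e)" by linarith+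
  qed
  have "0 < cos (n * e)"
    using small by (intro cos_gt_zero) auto
  moreover have "cos (n * e) < cos 0"
    using small by (intro cos_monotone_0_pi) auto
  ultimately have "0 < cos (n * e)" "cos (n * e) < 1" by simp_all
  then have c: "0 < c" "c < 1" "cos (n * e) < c" by (auto simp: c_def)
  define q where "q = (\<lambda>t :: real. cos (n * t) - c / f 0 * f (t - e))"
  have q: "trig_poly n q"
    unfolding q_def
    using trig_poly_mult[OF trig_poly_const[of "c / f 0"] trig_poly_shift[OF f(1), of e]]
    by (intro trig_poly_diff trig_poly_cos) simp
  have qc: "continuous_on UNIV q"
    unfolding q_def using max(1)
    by (intro continuous_intros continuous_on_compose2[OF f(2)]) auto
  have bnd: "c / f 0 * f t < 1" "- 1 < c / f 0 * f t" for t
  proof -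
    have "\<bar>c / f 0 * f t\<bar> = c * (\<bar>f t\<bar> / \<bar>f 0\<bar>)" using c by (simp add: abs_mult)
    also have "\<dots> \<le> c * 1" using max c by (intro mult_left_mono) (auto simp: divide_le_eq)
    finally have "\<bar>c / f 0 * f t\<bar> < 1" using c by simp
    then show "c / f 0 * f t < 1" "- 1 < c / f 0 * f t" by linarith+
  qed
  \<comment> \<open>At 0, pi/n, 2pi/n, ... the cosine is 1 or -1 and dominates the copy, so
    \<open>q\<close> alternates in sign. Between 0 and pi/n two more alternations are gained:
    \<open>q\<close> is negative at \<open>e\<close>, where the copy equals \<open>c\<close>, and
    positive at \<open>b + e\<close>, where the copy vanishes.\<close>
  define s where "s = (\<lambda>i :: nat. if i = 0 then 0 else if i = 1 then e else
    if i = 2 then b + e else (i - 2) * pi / n)"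
  have s_simps: "s 0 = 0" "s 1 = e" "s 2 = b + e" "\<And>i. i \<ge> 3 \<Longrightarrow> s i = (real i - 2) * pi / n"
    by (auto simp: s_def)
  have s3: "b + e < pi / n"
    using small n by (simp add: field_simps)
  have s_Suc: "s (Suc 0) = e" "s (Suc 1) = b + e" "s (Suc 2) = pi / n"
    by (simp_all add: s_def)
  have s_mono: "s i < s (Suc i)" for i
  proof -
    consider "i = 0" | "i = 1" | "i = 2" | "i \<ge> 3" by linarith
    then show ?thesis
    proof cases
      case 1
      show ?thesis unfolding 1 s_Suc s_simps using e by simp
    next
      case 2
      show ?thesis unfolding 2 s_Suc s_simps using b0 by simp
    next
      case 3
      show ?thesis unfolding 3 s_Suc s_simps by (rule s3)
    next
      case 4
      then show ?thesis using n s_simps(4)[of i] s_simps(4)[of "Suc i"]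
        by (simp add: divide_strict_right_mono)
    qed
  qed
  have sgn: "(-1) ^ i * q (s i) > 0" for i
  proof -
    consider "i = 0" | "i = 1" | "i = 2" | "i \<ge> 3" by linarith
    then show ?thesis
    proof cases
      case 1
      then show ?thesis using bnd[of "- e"] unfolding 1 s_simps q_def by simp
    next
      case 2
      show ?thesis unfolding 2 s_simps q_def using c max(1) by simp
    next
      case 3
      show ?thesis unfolding 3 s_simps q_def using fb cos_gt_zero[OF small(3,4)] by simp
    next
      case 4
      then obtain k where k: "i = k + 2" using that[of "i - 2"] by simp
      have "n * s i = k * pi" using 4 k n by (simp add: s_simps)
      then have "q (s i) = (-1) ^ k - c / f 0 * f (s i - e)"
        by (simp add: q_def cos_npi)
      moreover have "(-1::real) ^ i = (-1) ^ k" using k by simp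
      ultimately show ?thesis using bnd[of "s i - e"]
        by (cases "even k") simp_all
    qed
  qed
  have "q (s i) * q (s (Suc i)) < 0" for i
    using sgn[of i] sgn[of "Suc i"] by (cases "even i") (simp_all add: mult_less_0_iff)
  then obtain Z where Z: "finite Z" "card Z = 2 * n + 1" "Z \<subseteq> {s 0<..<s (2 * n + 1)}"
      "\<forall>x\<in>Z. q x = 0"
    using sign_changes_imp_zeros[OF qc, of "2 * n + 1" s] s_mono by auto
  \<comment> \<open>The last point is (2n - 1) pi/n, so all 2n + 1 zeros fit into one period, one
    more than a nonzero \<open>q\<close> may have.\<close>
  have "s (2 * n + 1) < 2 * pi" using n by (auto simp: s_simps field_simps)
  then have "Z \<subseteq> {0..<2 * pi}" using Z(3) by (force simp: s_simps)
  then have "q 0 = 0" using trig_poly_eq_0[OF q Z(1)] Z by auto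
  then show False using sgn[of 0] by (simp add: s_simps)
qed

section \<open>Products of affine functions along great circles\<close>

lemma norm_great_circle:
  fixes p u :: "'a :: real_inner"
  assumes "norm p = 1" "norm u = 1" "p \<bullet> u = 0"
  shows "norm (cos t *\<^sub>R p + sin t *\<^sub>R u) = 1"
proof -
  have "(norm (cos t *\<^sub>R p + sin t *\<^sub>R u))\<^sup>2 = (norm (cos t *\<^sub>R p))\<^sup>2 + (norm (sin t *\<^sub>R u))\<^sup>2"
    using assms(3) by (intro norm_add_Pythagorean) (simp add: orthogonal_def)
  also have "\<dots> = 1" using assms by (simp add: power_mult_distrib)
  finally show ?thesis by (simp add: power2_eq_1_iff) (metis norm_ge_zero neg_0_le_iff_le not_one_le_zero)
qed

lemma trig_poly_great_circle:
  "trig_poly 1 (\<lambda>t. (cos t *\<^sub>R p + sin t *\<^sub>R u) \<bullet> v - c)"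
  using trig_poly_linear[of "p \<bullet> v" "u \<bullet> v" "- c"]
  by (simp add: inner_add_left mult.commute)

text \<open>On a great circle through a suitable \<open>p\<close>, none of the affine functions
  vanishes identically. Each then has finitely many zeros there, and the circle is infinite.\<close>

lemma sphere_not_covered_by_hyperplanes:
  fixes v :: "'j \<Rightarrow> 'a :: euclidean_space"
  assumes "finite J" "DIM('a) \<ge> 2" "\<And>j. j \<in> J \<Longrightarrow> v j \<noteq> 0"
  obtains x where "norm x = 1" "\<And>j. j \<in> J \<Longrightarrow> x \<bullet> v j \<noteq> c j"
proof -
  \<comment> \<open>The point 0 is removed as well because \<open>x\<close> has to be normalised,
    even when \<open>J\<close> is empty.\<close>
  have "negligible ((\<Union>j\<in>J. {x. v j \<bullet> x = 0}) \<union> {0})"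
    using assms by (intro negligible_Un negligible_Union) (auto intro: negligible_hyperplane)
  then have "(\<Union>j\<in>J. {x. v j \<bullet> x = 0}) \<union> {0} \<noteq> UNIV"
    using non_negligible_UNIV by metis
  then obtain x where x: "x \<noteq> 0" "\<And>j. j \<in> J \<Longrightarrow> v j \<bullet> x \<noteq> 0" by blast
  obtain y where y: "y \<noteq> 0" "orthogonal x y"
    using orthogonal_to_vector_exists[OF assms(2)] by blast
  define p u where "p = x /\<^sub>R norm x" and "u = y /\<^sub>R norm y"
  have pu: "norm p = 1" "norm u = 1" "p \<bullet> u = 0"
    using x(1) y by (auto simp: p_def u_def orthogonal_def)
  define f where "f = (\<lambda>j t. (cos t *\<^sub>R p + sin t *\<^sub>R u) \<bullet> v j - c j)"
  have "finite {t \<in> {0..<2 * pi}. f j t = 0}" if j: "j \<in> J" for j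
  proof -
    have "p \<bullet> v j \<noteq> 0" using x j by (simp add: p_def inner_commute)
    \<comment> \<open>The values at the antipodal points p and -p differ by twice
      \<open>p \<bullet> v j\<close>, so they cannot both be 0.\<close>
    then have "f j 0 \<noteq> 0 \<or> f j pi \<noteq> 0" by (auto simp: f_def)
    moreover have "trig_poly 1 (f j)" unfolding f_def by (rule trig_poly_great_circle)
    ultimately show ?thesis using trig_poly_finite_zeros by blast
  qed
  then have "finite (\<Union>j\<in>J. {t \<in> {0..<2 * pi}. f j t = 0})" using assms(1) by blast
  moreover have "infinite {0..<2 * pi}" by (simp add: infinite_Ico)
  ultimately have "\<not> {0..<2 * pi} \<subseteq> (\<Union>j\<in>J. {t \<in> {0..<2 * pi}. f j t = 0})"
    using finite_subset by blast
  then obtain t where "t \<in> {0..<2 * pi}" "\<And>j. j \<in> J \<Longrightarrow> f j t \<noteq> 0"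
    by blast
  then show ?thesis
    using that[of "cos t *\<^sub>R p + sin t *\<^sub>R u"] norm_great_circle[OF pu] by (auto simp: f_def)
qed

text \<open>\<open>p\<close> maximises the absolute value of the product over the compact sphere.
  The maximum is nonzero by \<open>sphere_not_covered_by_hyperplanes\<close>, so
  \<open>trig_poly_zero_dist\<close> applies on each great circle through \<open>p\<close>, with
  \<open>t\<close> as the angle from \<open>p\<close>.\<close>

lemma sphere_point_far_from_hyperplanes:
  fixes v :: "'j \<Rightarrow> 'a :: euclidean_space"
  assumes J: "finite J" "card J \<le> n" "n > 0" and "DIM('a) \<ge> 2" "\<And>j. j \<in> J \<Longrightarrow> v j \<noteq> 0"
  obtains p where "norm p = 1"
    "\<And>u t j. j \<in> J \<Longrightarrow> norm u = 1 \<Longrightarrow> p \<bullet> u = 0 \<Longrightarrow> \<bar>t\<bar> < pi / (2 * n) \<Longrightarrow>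
       (cos t *\<^sub>R p + sin t *\<^sub>R u) \<bullet> v j \<noteq> c j"
proof -
  define P where "P = (\<lambda>x. \<Prod>j\<in>J. x \<bullet> v j - c j)"
  have P0: "P x = 0 \<longleftrightarrow> (\<exists>j\<in>J. x \<bullet> v j = c j)" for x
    using J(1) by (simp add: P_def)
  obtain x where x: "norm x = 1" "\<And>j. j \<in> J \<Longrightarrow> x \<bullet> v j \<noteq> c j"
    by (rule sphere_not_covered_by_hyperplanes[OF J(1) assms(4), of v c]) (use assms(5) in auto)
  then have Px: "P x \<noteq> 0" by (simp add: P0)
  have "continuous_on (sphere 0 1) (\<lambda>x. \<bar>P x\<bar>)"
    unfolding P_def by (intro continuous_intros)
  moreover have "sphere (0 :: 'a) 1 \<noteq> {}" using x(1) by auto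
  ultimately obtain p where p: "norm p = 1" "\<And>y. norm y = 1 \<Longrightarrow> \<bar>P y\<bar> \<le> \<bar>P p\<bar>"
    using continuous_attains_sup[of "sphere 0 1" "\<lambda>x. \<bar>P x\<bar>"] by auto
  have Pp: "P p \<noteq> 0" using p(2)[OF x(1)] Px by auto
  have nz: "P (cos t *\<^sub>R p + sin t *\<^sub>R u) \<noteq> 0"
    if u: "norm u = 1" "p \<bullet> u = 0" and t: "0 \<le> t" "t < pi / (2 * n)" for u t
  proof -
    define f where "f = (\<lambda>t. P (cos t *\<^sub>R p + sin t *\<^sub>R u))"
    have "trig_poly (card J) f"
      unfolding f_def P_def by (intro trig_poly_prod J(1) trig_poly_great_circle)
    then have "trig_poly n f" using J(2) trig_poly_mono by blast
    moreover have "continuous_on UNIV f"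
      unfolding f_def P_def by (intro continuous_intros)
    moreover have "f 0 = P p" by (simp add: f_def)
    moreover have "\<bar>f t\<bar> \<le> \<bar>P p\<bar>" for t
      unfolding f_def by (intro p(2) norm_great_circle[OF p(1) u])
    ultimately show ?thesis
      using trig_poly_zero_dist[of n f t] J(3) Pp t by (simp add: f_def)
  qed
  show ?thesis
  proof (rule that[OF p(1)])
    fix u t j
    assume j: "j \<in> J" and u: "norm u = 1" "p \<bullet> u = 0" and t: "\<bar>t\<bar> < pi / (2 * n)"
    \<comment> \<open>A negative angle in direction \<open>u\<close> is a positive angle in
      direction \<open>- u\<close>.\<close>
    have "P (cos t *\<^sub>R p + sin t *\<^sub>R u) \<noteq> 0"
    proof (cases "t \<ge> 0")
      case True
      then show ?thesis using nz[OF u] t by simp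
    next
      case False
      then show ?thesis using nz[of "- u" "- t"] u t by simp
    qed
    then show "(cos t *\<^sub>R p + sin t *\<^sub>R u) \<bullet> v j \<noteq> c j" using j P0 by blast
  qed
qed

section \<open>From caps to zones, and the covering argument\<close>

text \<open>The numbers (2k + 1) r/m - r are the midpoints of the m equal pieces of [-r, r], each of
  half-length r/m.\<close>

lemma exists_nearby_midpoint:
  fixes m :: nat
  assumes "m > 0" "\<bar>x\<bar> \<le> r"
  shows "\<exists>k<m. \<bar>(2 * real k + 1) * r / m - r - x\<bar> \<le> r / m"
proof (cases "r = 0")
  case True
  then show ?thesis using assms by (intro exI[of _ 0]) simp
next
  case False
  then have r: "r > 0" using assms by linarith
  define w where "w = (x + r) / (2 * r)"
  \<comment> \<open>The position of \<open>x\<close> counted in pieces from the left end. Its floor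
    is the index of the piece, except at the right end \<open>y = m\<close>, which goes to the last
    piece \<open>m - 1\<close>.\<close>
  define y where "y = w * m"
  have "0 \<le> w" "w \<le> 1" using assms(2) r by (auto simp: w_def abs_le_iff)
  then have y: "0 \<le> y" "y \<le> m"
    using mult_left_le_one_le[of "real m" w] by (simp_all add: y_def)
  obtain k :: nat where k: "k < m" "\<bar>2 * real k + 1 - 2 * y\<bar> \<le> 1"
  proof (cases "y = m")
    case True
    then show ?thesis using that[of "m - 1"] assms(1) by (simp add: of_nat_diff)
  next
    case False
    have "real (nat \<lfloor>y\<rfloor>) = of_int \<lfloor>y\<rfloor>" using y by simp
    then have "real (nat \<lfloor>y\<rfloor>) \<le> y" "y < real (nat \<lfloor>y\<rfloor>) + 1" by linarith+
    moreover from this(1) have "nat \<lfloor>y\<rfloor> < m" using False y(2) by linarith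
    ultimately show ?thesis by (intro that[of "nat \<lfloor>y\<rfloor>"]) linarith+
  qed
  have "(2 * real k + 1) * r / m - r - x = (r / m) * (2 * real k + 1 - 2 * y)"
    using r assms(1) by (simp add: y_def w_def field_simps)
  then have "\<bar>(2 * real k + 1) * r / m - r - x\<bar> = (r / m) * \<bar>2 * real k + 1 - 2 * y\<bar>"
    using r by (simp add: abs_mult)
  also have "\<dots> \<le> (r / m) * 1" using k r by (intro mult_left_mono) auto
  finally show ?thesis using k by auto
qed

text \<open>Since \<open>a\<close> and \<open>x\<close> are orthonormal, Bessel's inequality bounds
  the sum of the squares of \<open>c \<bullet> x\<close> and \<open>a \<bullet> c\<close> by 1.
  Membership in the cap gives \<open>c \<bullet> x\<close> at least cos r, which is nonnegative and
  may be squared.\<close>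

lemma zone_of_cap_meets_great_sphere:
  fixes a c x :: "'a :: euclidean_space"
  assumes "norm a = 1" "norm c = 1" "x \<in> cap c r" "a \<bullet> x = 0" "0 \<le> r" "r < pi / 2"
  shows "\<bar>a \<bullet> c\<bar> \<le> sin r"
proof -
  have x: "norm x = 1" "arccos (c \<bullet> x) \<le> r" using assms(3) by (auto simp: cap_def spherical_dist_def)
  have "\<bar>c \<bullet> x\<bar> \<le> 1" using Cauchy_Schwarz_ineq2[of c x] assms(2) x(1) by simp
  then have "cos (arccos (c \<bullet> x)) = c \<bullet> x" "0 \<le> arccos (c \<bullet> x)"
    by (auto intro!: cos_arccos_abs arccos_lbound)
  then have "cos r \<le> c \<bullet> x" using cos_monotone_0_pi_le[OF _ x(2)] assms(6) pi_gt_zero by linarith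
  moreover have "0 \<le> cos r" using assms by (intro cos_ge_zero) auto
  ultimately have cr: "(cos r)\<^sup>2 \<le> (c \<bullet> x)\<^sup>2" by (intro power_mono)
  have "0 \<le> (norm (c - (c \<bullet> x) *\<^sub>R x - (a \<bullet> c) *\<^sub>R a))\<^sup>2" by simp
  also have "\<dots> = 1 - (c \<bullet> x)\<^sup>2 - (a \<bullet> c)\<^sup>2"
    using assms(1,2,4) x(1) unfolding power2_norm_eq_inner norm_eq_1
    by (simp add: inner_diff_left inner_diff_right inner_commute power2_eq_square)
  finally have "(a \<bullet> c)\<^sup>2 \<le> (sin r)\<^sup>2" using cr by (simp add: sin_squared_eq)
  moreover have "0 \<le> sin r" using assms by (intro sin_ge_zero) auto
  ultimately show ?thesis by (metis abs_le_square_iff abs_of_nonneg)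
qed

text \<open>If the sum were smaller, the point \<open>p\<close> far from all middle hyperplanes
  would still lie in some zone \<open>i\<close>. Rotating it towards or away from \<open>c i\<close>
  by less than pi/(2N) would then reach one of these hyperplanes.\<close>

theorem zones_covering_sphere:
  fixes c :: "'i \<Rightarrow> 'a :: euclidean_space" and r :: "'i \<Rightarrow> real"
  assumes I: "finite I" and dim: "DIM('a) \<ge> 2"
    and c: "\<And>i. i \<in> I \<Longrightarrow> norm (c i) = 1" and r: "\<And>i. i \<in> I \<Longrightarrow> 0 \<le> r i"
    and cover: "\<And>a. norm a = 1 \<Longrightarrow> \<exists>i\<in>I. \<bar>a \<bullet> c i\<bar> \<le> sin (r i)"
  shows "pi / 2 \<le> sum r I"
proof (rule ccontr)
  assume "\<not> pi / 2 \<le> sum r I"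
  then have S: "sum r I < pi / 2" by simp
  have r2: "r i < pi / 2" if "i \<in> I" for i
    using member_le_sum[of i I r] that r I S by force
  \<comment> \<open>Rounding up the number of pieces costs at most one per zone. \<open>N\<close> is
    large enough for the slack N (1 - 2 S/pi), with S the sum of the radii, to exceed this cost
    \<open>card I\<close>.\<close>
  obtain N :: nat where "card I / (1 - 2 * sum r I / pi) < N" using reals_Archimedean2 by blast
  moreover have "0 < 1 - 2 * sum r I / pi" using S by (simp add: field_simps)
  ultimately have N: "card I + 2 * N * sum r I / pi < N"
    by (simp add: field_simps)
  then have N0: "N > 0" by (cases N) auto
  \<comment> \<open>Floor plus one, not the ceiling: this makes r/m strictly less than pi/(2N) and
    leaves one piece for a zone of half-width 0.\<close>
  define m where "m = (\<lambda>i. nat \<lfloor>2 * N * r i / pi\<rfloor> + 1)"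
  have m: "r i / m i < pi / (2 * N)" "m i \<le> 2 * N * r i / pi + 1" if "i \<in> I" for i
  proof -
    have "0 \<le> 2 * N * r i / pi" using r[OF that] by simp
    then have "real (m i) = of_int \<lfloor>2 * N * r i / pi\<rfloor> + 1" by (simp add: m_def)
    then have *: "2 * N * r i / pi < m i" "m i \<le> 2 * N * r i / pi + 1" by linarith+
    then show "m i \<le> 2 * N * r i / pi + 1" by blast
    show "r i / m i < pi / (2 * N)" using *(1) N0 by (simp add: field_simps m_def)
  qed
  define J where "J = (SIGMA i:I. {..<m i})"
  have "real (card J) = (\<Sum>i\<in>I. real (m i))" using I by (simp add: J_def)
  also have "\<dots> \<le> (\<Sum>i\<in>I. 2 * N * r i / pi + 1)" using m(2) by (intro sum_mono)
  also have "\<dots> = card I + 2 * N * sum r I / pi"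
    by (simp add: sum.distrib sum_distrib_left sum_divide_distrib)
  finally have "card J \<le> N" using N by linarith
  moreover have "finite J" using I by (simp add: J_def)
  ultimately have J: "finite J" "card J \<le> N" by blast+
  \<comment> \<open>The latitude, relative to the great sphere orthogonal to \<open>c i\<close>, of
    the middle of piece \<open>k\<close>; the matching hyperplane is at height sin h along
    \<open>c i\<close>.\<close>
  define h where "h = (\<lambda>(i, k). (2 * real k + 1) * r i / m i - r i)"
  obtain p where p: "norm p = 1"
    "\<And>u t j. j \<in> J \<Longrightarrow> norm u = 1 \<Longrightarrow> p \<bullet> u = 0 \<Longrightarrow> \<bar>t\<bar> < pi / (2 * N) \<Longrightarrow>
       (cos t *\<^sub>R p + sin t *\<^sub>R u) \<bullet> c (fst j) \<noteq> sin (h j)"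
  proof (rule sphere_point_far_from_hyperplanes[OF J N0 dim, of "\<lambda>j. c (fst j)" "\<lambda>j. sin (h j)"])
    show "c (fst j) \<noteq> 0" if "j \<in> J" for j
      using that c[of "fst j"] by (auto simp: J_def)
  qed blast
  obtain i where i: "i \<in> I" "\<bar>p \<bullet> c i\<bar> \<le> sin (r i)" using cover[OF p(1)] by blast
  define \<phi> where "\<phi> = arcsin (p \<bullet> c i)"
  have "sin (r i) < 1" using sin_monotone_2pi[of "r i" "pi / 2"] r2[OF i(1)] r[OF i(1)] by simp
  then have pc: "\<bar>p \<bullet> c i\<bar> < 1" using i(2) by linarith
  have sin_phi: "sin \<phi> = p \<bullet> c i" using pc by (simp add: \<phi>_def)
  have phi: "\<bar>\<phi>\<bar> \<le> r i"
  proof -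
    have "arcsin (sin (r i)) = r i" "arcsin (sin (- r i)) = - r i"
      using r[OF i(1)] r2[OF i(1)] by (intro arcsin_sin; simp)+
    moreover have "arcsin (p \<bullet> c i) \<le> arcsin (sin (r i))"
      using i(2) pc by (intro arcsin_le_arcsin) auto
    moreover have "arcsin (sin (- r i)) \<le> arcsin (p \<bullet> c i)"
      using i(2) pc \<open>sin (r i) < 1\<close> by (intro arcsin_le_arcsin) auto
    ultimately show ?thesis by (simp add: \<phi>_def abs_le_iff)
  qed
  have cos_phi: "cos \<phi> > 0" using phi r2[OF i(1)] by (intro cos_gt_zero_pi) auto
  \<comment> \<open>The unit tangent at \<open>p\<close> pointing towards \<open>c i\<close>. Along
    this circle the latitude starts at \<phi> and grows at unit speed: the inner product with
    \<open>c i\<close> at angle t is sin (\<phi> + t). Taking t = h - \<phi> lands on a middle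
    hyperplane.\<close>
  define u where "u = (c i - (p \<bullet> c i) *\<^sub>R p) /\<^sub>R cos \<phi>"
  have pp: "p \<bullet> p = 1" "c i \<bullet> c i = 1" using p(1) c[OF i(1)] by (simp_all add: norm_eq_1)
  have pu: "p \<bullet> u = 0" by (simp add: u_def inner_diff_right pp)
  have cs: "1 - (p \<bullet> c i) * (p \<bullet> c i) = cos \<phi> * cos \<phi>"
    using sin_cos_squared_add3[of \<phi>] sin_phi by simp
  have uc: "u \<bullet> c i = cos \<phi>" using cs cos_phi by (simp add: u_def inner_diff_left pp)
  have "u \<bullet> u = u \<bullet> ((c i - (p \<bullet> c i) *\<^sub>R p) /\<^sub>R cos \<phi>)" by (simp add: u_def)
  also have "\<dots> = 1" using cos_phi pu by (simp add: inner_diff_right uc inner_commute)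
  finally have u: "norm u = 1" by (simp add: norm_eq_1)
  obtain k where k: "k < m i" "\<bar>h (i, k) - \<phi>\<bar> \<le> r i / m i"
    using exists_nearby_midpoint[of "m i" \<phi> "r i"] phi by (auto simp: h_def m_def)
  have "\<bar>h (i, k) - \<phi>\<bar> < pi / (2 * N)" using k(2) m(1)[OF i(1)] by linarith
  from p(2)[OF _ u pu this, of "(i, k)"]
  have "cos (h (i, k) - \<phi>) * sin \<phi> + sin (h (i, k) - \<phi>) * cos \<phi> \<noteq> sin (h (i, k))"
    using k(1) i(1) by (simp add: J_def inner_add_left uc sin_phi)
  moreover have "sin (h (i, k)) = sin ((h (i, k) - \<phi>) + \<phi>)" by simp
  ultimately show False unfolding sin_add by simp
qed

theorem corollary3:
  fixes d n :: nat
    and D :: "nat \<Rightarrow> (real ^ 'n) set"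
    and r :: "nat \<Rightarrow> real"
  assumes "d \<ge> 1"
    and "CARD('n) = d + 1"
    and "\<And>i. i \<in> {1..n} \<Longrightarrow> is_cap_of_radius (D i) (r i)"
    and "\<And>G :: (real ^ 'n) set. great_sphere G \<Longrightarrow> \<exists>i \<in> {1..n}. G \<inter> D i \<noteq> {}"
  shows "(\<Sum>i = 1..n. r i) \<ge> pi / 2"
proof (rule ccontr)
  assume "\<not> pi / 2 \<le> sum r {1..n}"
  then have S: "sum r {1..n} < pi / 2" by simp
  have r0: "0 \<le> r i" if "i \<in> {1..n}" for i
    using assms(3)[OF that] by (simp add: is_cap_of_radius_def)
  \<comment> \<open>The proof is by contradiction to get this bound, under which meeting a cap
    translates into a zone condition on the normal \<open>a\<close>.\<close>
  have r2: "r i < pi / 2" if "i \<in> {1..n}" for i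
    using member_le_sum[of i "{1..n}" r] that r0 S by force
  have "\<forall>i\<in>{1..n}. \<exists>c. norm c = 1 \<and> D i = cap c (r i)"
    using assms(3) unfolding is_cap_of_radius_def by (metis mem_sphere_0)
  then obtain c where c: "\<And>i. i \<in> {1..n} \<Longrightarrow> norm (c i) = 1"
    "\<And>i. i \<in> {1..n} \<Longrightarrow> D i = cap (c i) (r i)"
    by metis
  have "pi / 2 \<le> sum r {1..n}"
  proof (rule zones_covering_sphere[of _ c])
    show "DIM(real ^ 'n) \<ge> 2" using assms(1,2) by simp
    fix a :: "real ^ 'n"
    assume a: "norm a = 1"
    then have "great_sphere (sphere 0 1 \<inter> {x. a \<bullet> x = 0})"
      unfolding great_sphere_def by (intro exI[of _ a]) auto
    then obtain i x where "i \<in> {1..n}" "x \<in> D i" "a \<bullet> x = 0"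
      using assms(4) by blast
    then show "\<exists>i\<in>{1..n}. \<bar>a \<bullet> c i\<bar> \<le> sin (r i)"
      using zone_of_cap_meets_great_sphere[OF a c(1) _ _ r0 r2] c(2) by metis
  qed (use c r0 in auto)
  then show False using S by simp
qed

end
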